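(* Let $A=A^\top\in\mathbb{R}^{3\times3}$ be such that $\bar A=\frac12(\mathrm{tr}(A)I-A)$ is positive definite. Let $\epsilon,\gamma>0$ be such that $\gamma<[1+\epsilon]^{-1}$, and put $\xi_0=1-\gamma\epsilon/(1-\gamma)$. Consider the attitude kinematics $\dot R=R[\omega]_\times$ on $SO(3)$, with angular velocity $\omega(t)\in\mathbb{R}^3$, coupled with the attitude observer (with error-free measurements) $$\dot{\hat R}=\hat R[\omega]_\times-[\sigma_{k_3}]_\times\hat R,\qquad \sigma_{k_3}=-k_3(R\hat R^\top)\,\psi(AR\hat R^\top),\qquad \hat R(0)\in SO(3),$$ where $k_3(\tilde R)=[1+\epsilon-|\tilde R|_I^2]^{-1}$, and let $\tilde R=R\hat R^\top$. Then, for any $\tilde R(0)\in\mathcal{B}_{\xi_0}=\{\tilde R\in SO(3): |\tilde R|_I^2<\xi_0\}$, one has $$|\tilde R(0)|_I\,e^{-\lambda_{\max}^{\bar A}t}\le|\tilde R(t)|_I\le|\tilde R(0)|_I\,e^{-\gamma\lambda_{\min}^{\bar A}t},\qquad\forall t\ge0.$$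
   Context: $SO(3)=\{R\in\mathbb{R}^{3\times3}: \det R=1,\ RR^\top=I\}$. $[x]_\times$ is the skew-symmetric matrix with $[x]_\times y=x\times y$ for $x,y\in\mathbb{R}^3$; $\mathrm{vex}$ is the inverse of $x\mapsto[x]_\times$ on skew-symmetric matrices. For $M\in\mathbb{R}^{3\times3}$, $\psi(M)=\mathrm{vex}\big((M-M^\top)/2\big)$. For $R\in SO(3)$, $|R|_I\in[0,1]$ is defined by $|R|_I^2=\frac14\mathrm{tr}(I-R)$. $\lambda_{\min}^{\bar A}$ and $\lambda_{\max}^{\bar A}$ are the minimum and maximum eigenvalues of $\bar A$. *)

theory Defs
  imports "HOL-Analysis.Analysis"
begin

definition SO3 :: "(real^3^3) set" where
  "SO3 = {R. rotation_matrix R}"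

lemma SO3_eq: "SO3 = {R. det R = 1 \<and> R ** transpose R = mat 1}"
  unfolding SO3_def rotation_matrix_def orthogonal_matrix_def
  using matrix_left_right_inverse by blast

definition skew :: "real^3 \<Rightarrow> real^3^3" where
  "skew x = matrix (\<lambda>y. cross3 x y)"

lemma skew_mult: "skew x *v y = cross3 x y"
  by (simp add: skew_def matrix_def matrix_vector_mult_def vec_eq_iff forall_3 sum_3 cross3_def axis_def)

lemma transpose_skew: "transpose (skew x) = - skew x"
  by (simp add: skew_def matrix_def transpose_def vec_eq_iff forall_3 cross3_def axis_def)

text \<open>The value is meaningful only for skew-symmetric arguments.\<close>
definition vex :: "real^3^3 \<Rightarrow> real^3" where
  "vex M = inv skew M"

lemma vex_skew: "vex (skew x) = x"
proof -
  have "inj skew"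
    by (rule injI) (auto simp: skew_def matrix_def vec_eq_iff forall_3 cross3_def axis_def)
  then show ?thesis by (simp add: vex_def)
qed

lemma skew_vex:
  assumes "transpose M = - M"
  shows "skew (vex M) = M"
proof -
  have neg: "M$i$j = - M$j$i" for i j
    using arg_cong[OF assms, of "\<lambda>N. N$j$i"] by (simp add: transpose_def)
  have diag: "M$1$1 = 0" "M$2$2 = 0" "M$3$3 = 0"
    using neg[of 1 1] neg[of 2 2] neg[of 3 3] by linarith+
  have "M = skew (vector [M$3$2, M$1$3, M$2$1])"
    by (simp add: skew_def matrix_def vec_eq_iff forall_3 cross3_def axis_def diag
        neg[of 1 2] neg[of 2 3] neg[of 3 1])
  then show ?thesis by (metis vex_skew)
qed

definition psi :: "real^3^3 \<Rightarrow> real^3" where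
  "psi M = vex ((1/2) *\<^sub>R (M - transpose M))"

text \<open>On \<open>SO3\<close> the radicand lies in \<open>{0..1}\<close>, so that
  \<open>(att_norm R)\<^sup>2 = trace (mat 1 - R) / 4\<close> there.\<close>
definition att_norm :: "real^3^3 \<Rightarrow> real" where
  "att_norm R = sqrt (trace (mat 1 - R) / 4)"

definition att_ball :: "real \<Rightarrow> (real^3^3) set" where
  "att_ball \<xi> = {R \<in> SO3. (att_norm R)\<^sup>2 < \<xi>}"

definition bar :: "real^3^3 \<Rightarrow> real^3^3" where
  "bar A = (1/2) *\<^sub>R (trace A *\<^sub>R mat 1 - A)"

definition pos_def :: "real^'n^'n \<Rightarrow> bool" where
  "pos_def M \<longleftrightarrow> transpose M = M \<and> (\<forall>x. x \<noteq> 0 \<longrightarrow> x \<bullet> (M *v x) > 0)"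

text \<open>Only real eigenvalues are collected; for a symmetric matrix these are all of them, and
  they form a finite nonempty set, so that \<open>Min\<close> and \<open>Max\<close> below are attained.\<close>
definition eigenvalues :: "real^'n^'n \<Rightarrow> real set" where
  "eigenvalues M = {c. \<exists>v. v \<noteq> 0 \<and> M *v v = c *\<^sub>R v}"

definition lambda_min :: "real^'n^'n \<Rightarrow> real" where
  "lambda_min M = Min (eigenvalues M)"

definition lambda_max :: "real^'n^'n \<Rightarrow> real" where
  "lambda_max M = Max (eigenvalues M)"

definition gain_k3 :: "real \<Rightarrow> real^3^3 \<Rightarrow> real" where
  "gain_k3 \<epsilon> Q = inverse (1 + \<epsilon> - (att_norm Q)\<^sup>2)"

definition sigma_k3 :: "real \<Rightarrow> real^3^3 \<Rightarrow> real^3^3 \<Rightarrow> real^3^3 \<Rightarrow> real^3" where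
  "sigma_k3 \<epsilon> A R Rh = - gain_k3 \<epsilon> (R ** transpose Rh) *\<^sub>R psi (A ** R ** transpose Rh)"

end

theory Submission
  imports Defs
begin

text \<open>The error \<open>Q = R ** transpose Rh\<close> satisfies the autonomous equation \<open>Q' = Q ** skew \<sigma>\<close> with
  \<open>\<sigma> = - k * psi (A ** Q)\<close>: the angular velocity drops out
  (\<open>attitude_error_derivative\<close>). Such an equation keeps \<open>Q\<close> in \<^const>\<open>SO3\<close>
  (\<open>rotation_flow\<close>). The Lyapunov function is \<open>V\<close>, the square of \<^const>\<open>att_norm\<close> along
  \<open>Q\<close>. It is affine in \<open>Q\<close> and satisfies
  \<open>V' = - (k / 2) * (psi Q \<bullet> psi (A ** Q))\<close>.

  Two identities on \<^const>\<open>SO3\<close> turn this into a scalar differential inequality: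
  \<open>psi Q \<bullet> psi (A ** Q) = psi Q \<bullet> (bar A *v psi Q)\<close>
  (\<open>psi_inner_psi_mult_eq_quadratic_form\<close>) and \<open>psi Q \<bullet> psi Q = 4 * V * (1 - V)\<close>
  (\<open>psi_inner_psi_rotation\<close>). Since the quadratic form of the symmetric matrix \<open>bar A\<close> lies between
  its extreme eigenvalues times the squared length, \<open>- V'\<close> lies between
  \<open>2 * k * (1 - V) * V\<close> times the least and times the greatest eigenvalue.

  The gain \<open>k = 1 / (1 + \<epsilon> - V)\<close> is designed to cancel the factor \<open>1 - V\<close>, which would otherwise slow
  the convergence near the rotations by \<open>\<pi>\<close>. Always \<open>k * (1 - V) \<le> 1\<close>, and
  \<open>\<gamma> \<le> k * (1 - V)\<close> holds exactly when \<open>V \<le> \<xi>\<^sub>0\<close>. As \<open>V\<close> is nonincreasing it stays below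
  \<open>\<xi>\<^sub>0\<close>, so both inequalities hold at all times, \<open>exponential_comparison\<close> gives exponential bounds on
  \<open>V\<close>, and square roots halve the rates.\<close>

section \<open>Extreme eigenvalues of symmetric matrices\<close>

lemma symmetric_matrix_dot:
  fixes M :: "real^'n^'n"
  assumes "transpose M = M"
  shows "x \<bullet> (M *v y) = (M *v x) \<bullet> y"
  by (metis assms dot_lmul_matrix transpose_matrix_vector)

text \<open>A semidefinite form is minimal wherever it vanishes, so its gradient vanishes there too.
  Concretely, stepping from \<open>v\<close> in the direction \<open>- (N *v v)\<close> would make the form negative
  to first order.\<close>

lemma psd_kernel:
  fixes N :: "real^'n^'n"
  assumes sym: "transpose N = N" and psd: "\<And>x. x \<bullet> (N *v x) \<ge> 0" and "v \<bullet> (N *v v) = 0"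
  shows "N *v v = 0"
proof (rule ccontr)
  define w where "w = N *v v"
  define a b where "a = w \<bullet> w" and "b = w \<bullet> (N *v w)"
  assume "N *v v \<noteq> 0"
  then have "a > 0" by (simp add: a_def w_def)
  have "b \<ge> 0" unfolding b_def by (rule psd)
  have vNw: "v \<bullet> (N *v w) = a"
    using symmetric_matrix_dot[OF sym, of v w] by (simp add: a_def w_def)
  \<comment> \<open>Along \<open>v + t *\<^sub>R w\<close> the form is \<open>2 * t * a + t\<^sup>2 * b\<close>. Its minimiser is \<open>- a / b\<close>;
    the shift by 1 covers \<open>b = 0\<close> and still gives a negative value.\<close>
  define t where "t = - a / (b + 1)"
  have "0 \<le> (v + t *\<^sub>R w) \<bullet> (N *v (v + t *\<^sub>R w))" by (rule psd)
  also have "\<dots> = 2 * t * a + t\<^sup>2 * b"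
    using assms(3) vNw
    by (simp add: matrix_vector_right_distrib matrix_vector_mult_scaleR inner_add_left inner_add_right
        a_def b_def w_def[symmetric] power2_eq_square distrib_left)
  also have "\<dots> = - (a\<^sup>2 * (b + 2)) / (b + 1)\<^sup>2"
    using \<open>b \<ge> 0\<close> by (simp add: t_def divide_simps power2_eq_square) (simp add: algebra_simps)
  also have "\<dots> < 0"
    using \<open>a > 0\<close> \<open>b \<ge> 0\<close> by (simp add: divide_simps)
  finally show False by simp
qed

text \<open>Eigenvectors of a symmetric matrix for different eigenvalues are orthogonal, hence independent,
  so there are at most as many eigenvalues as dimensions. Finiteness is what gives
  \<^const>\<open>Min\<close> and \<^const>\<open>Max\<close> in \<^const>\<open>lambda_min\<close> and \<^const>\<open>lambda_max\<close> their meaning.\<close>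

lemma finite_eigenvalues:
  fixes M :: "real^'n^'n"
  assumes sym: "transpose M = M"
  shows "finite (eigenvalues M)"
proof -
  have "\<forall>c\<in>eigenvalues M. \<exists>v. v \<noteq> 0 \<and> M *v v = c *\<^sub>R v"
    by (auto simp: eigenvalues_def)
  then obtain v where v: "\<And>c. c \<in> eigenvalues M \<Longrightarrow> v c \<noteq> 0 \<and> M *v v c = c *\<^sub>R v c"
    by metis
  have orth: "v c \<bullet> v d = 0" if "c \<in> eigenvalues M" "d \<in> eigenvalues M" "c \<noteq> d" for c d
    using symmetric_matrix_dot[OF sym, of "v c" "v d"] v that by auto
  have "inj_on v (eigenvalues M)"
    using orth v by (metis inj_onI inner_eq_zero_iff)
  moreover have "independent (v ` eigenvalues M)"
    using orth v by (intro pairwise_orthogonal_independent) (auto simp: pairwise_def orthogonal_def)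
  ultimately show ?thesis
    using finite_imageD finiteI_independent by blast
qed

text \<open>The quadratic form attains a minimum \<open>c\<close> on the compact unit sphere, so \<open>M - c *\<^sub>R mat 1\<close> is
  semidefinite and its form vanishes at a minimiser, which \<open>psd_kernel\<close> makes an eigenvector.\<close>

lemma rayleigh_minimum_eigenvalue:
  fixes M :: "real^'n^'n"
  assumes sym: "transpose M = M"
  obtains c where "c \<in> eigenvalues M" "\<And>x. c * (x \<bullet> x) \<le> x \<bullet> (M *v x)"
proof -
  have "sphere (0::real^'n) 1 \<noteq> {}"
    by simp
  moreover have "continuous_on (sphere 0 1) (\<lambda>x::real^'n. x \<bullet> (M *v x))"
    by (intro continuous_intros matrix_vector_mult_linear_continuous_on)
  ultimately obtain v where v: "norm v = 1"
      and min: "\<And>y::real^'n. norm y = 1 \<Longrightarrow> v \<bullet> (M *v v) \<le> y \<bullet> (M *v y)"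
    using continuous_attains_inf[of "sphere 0 1" "\<lambda>x::real^'n. x \<bullet> (M *v x)"] by auto
  define c where "c = v \<bullet> (M *v v)"
  have low: "c * (x \<bullet> x) \<le> x \<bullet> (M *v x)" for x
  proof (cases "x = 0")
    case False
    then have "c \<le> (x /\<^sub>R norm x) \<bullet> (M *v (x /\<^sub>R norm x))"
      unfolding c_def by (intro min) simp
    also have "\<dots> = (x \<bullet> (M *v x)) / (norm x)\<^sup>2"
      by (simp add: matrix_vector_mult_scaleR power2_eq_square divide_simps)
    finally show ?thesis
      using False by (simp add: field_simps power2_norm_eq_inner)
  qed simp
  define N where "N = M - c *\<^sub>R mat 1"
  have Nx: "N *v x = M *v x - c *\<^sub>R x" for x
    by (simp add: N_def matrix_vector_mult_diff_rdistrib scaleR_matrix_vector_assoc[symmetric])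
  have "transpose N = N"
    using sym by (simp add: N_def transpose_def vec_eq_iff mat_def)
  moreover have "v \<bullet> (N *v v) = 0"
    using v by (simp add: Nx inner_diff_right c_def norm_eq_1)
  ultimately have "N *v v = 0"
    using low by (intro psd_kernel) (auto simp: Nx inner_diff_right)
  then have "c \<in> eigenvalues M"
    using v by (auto simp: eigenvalues_def Nx intro!: exI[of _ v])
  with low show thesis using that by blast
qed

lemma lambda_min_le_quadratic_form:
  fixes M :: "real^'n^'n"
  assumes "transpose M = M"
  shows "lambda_min M * (x \<bullet> x) \<le> x \<bullet> (M *v x)"
proof -
  obtain c where c: "c \<in> eigenvalues M" "c * (x \<bullet> x) \<le> x \<bullet> (M *v x)"
    using rayleigh_minimum_eigenvalue[OF assms] by metis
  have "lambda_min M \<le> c"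
    unfolding lambda_min_def using finite_eigenvalues[OF assms] c(1) by simp
  then show ?thesis
    using c(2) by (meson inner_ge_zero mult_right_mono order_trans)
qed

lemma matrix_vector_mult_uminus_left:
  fixes M :: "real^'n^'m"
  shows "(- M) *v x = - (M *v x)"
  by (simp add: matrix_vector_mult_def vec_eq_iff sum_negf)

lemma quadratic_form_le_lambda_max:
  fixes M :: "real^'n^'n"
  assumes "transpose M = M"
  shows "x \<bullet> (M *v x) \<le> lambda_max M * (x \<bullet> x)"
proof -
  have sym: "transpose (- M) = - M"
    using assms by (simp add: transpose_def vec_eq_iff)
  obtain c where c: "c \<in> eigenvalues (- M)" "c * (x \<bullet> x) \<le> x \<bullet> ((- M) *v x)"
    using rayleigh_minimum_eigenvalue[OF sym] by metis
  then have "- c \<in> eigenvalues M"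
    by (auto simp: eigenvalues_def matrix_vector_mult_uminus_left neg_eq_iff_add_eq_0 eq_neg_iff_add_eq_0 add.commute)
  then have "- c \<le> lambda_max M"
    unfolding lambda_max_def using finite_eigenvalues[OF assms] by simp
  then have "- c * (x \<bullet> x) \<le> lambda_max M * (x \<bullet> x)"
    by (intro mult_right_mono) auto
  then show ?thesis
    using c(2) by (simp add: matrix_vector_mult_uminus_left)
qed

lemma pos_def_lambda_min_pos:
  fixes M :: "real^'n^'n"
  assumes "pos_def M"
  shows "lambda_min M > 0"
proof -
  have sym: "transpose M = M" and pos: "\<And>x. x \<noteq> 0 \<Longrightarrow> x \<bullet> (M *v x) > 0"
    using assms by (auto simp: pos_def_def)
  have "eigenvalues M \<noteq> {}"
    using rayleigh_minimum_eigenvalue[OF sym] by blast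
  then have "lambda_min M \<in> eigenvalues M"
    unfolding lambda_min_def using finite_eigenvalues[OF sym] by simp
  then obtain v where "v \<noteq> 0" "M *v v = lambda_min M *\<^sub>R v"
    by (auto simp: eigenvalues_def)
  then have "0 < lambda_min M * (v \<bullet> v)"
    using pos[of v] by simp
  then show ?thesis
    by (rule zero_less_mult_pos2) (use \<open>v \<noteq> 0\<close> in simp)
qed

section \<open>Linearity of matrix operations\<close>

lemma bounded_bilinear_matrix_mult:
  "bounded_bilinear ((**) :: real^'n^'m \<Rightarrow> real^'k^'n \<Rightarrow> real^'k^'m)"
  unfolding bilinear_conv_bounded_bilinear[symmetric] bilinear_def
  by (auto intro!: linearI simp: matrix_matrix_mult_def vec_eq_iff sum.distrib sum_distrib_left
      algebra_simps)

lemmas matrix_mult_diff_left = bounded_bilinear.diff_left[OF bounded_bilinear_matrix_mult]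
  and matrix_mult_diff_right = bounded_bilinear.diff_right[OF bounded_bilinear_matrix_mult]
  and matrix_mult_scaleR_left = bounded_bilinear.scaleR_left[OF bounded_bilinear_matrix_mult]
  and matrix_mult_scaleR_right = bounded_bilinear.scaleR_right[OF bounded_bilinear_matrix_mult]
  and matrix_mult_minus_right = bounded_bilinear.minus_right[OF bounded_bilinear_matrix_mult]
  and matrix_mult_minus_left = bounded_bilinear.minus_left[OF bounded_bilinear_matrix_mult]
  and has_vector_derivative_matrix_mult =
    bounded_bilinear.has_vector_derivative[OF bounded_bilinear_matrix_mult]

lemma bounded_linear_transpose: "bounded_linear (transpose :: real^'n^'m \<Rightarrow> real^'m^'n)"
  unfolding linear_conv_bounded_linear[symmetric]
  by (intro linearI) (simp_all add: transpose_def vec_eq_iff)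

lemma bounded_linear_trace: "bounded_linear (trace :: real^'n^'n \<Rightarrow> real)"
  unfolding linear_conv_bounded_linear[symmetric]
  by (intro linearI) (simp_all add: trace_def sum.distrib sum_distrib_left)

lemmas trace_scaleR = linear_scale[OF bounded_linear.linear[OF bounded_linear_trace]]
  and has_vector_derivative_transpose = bounded_linear.has_vector_derivative[OF bounded_linear_transpose]
  and has_vector_derivative_trace = bounded_linear.has_vector_derivative[OF bounded_linear_trace]

lemma trace_transpose: "trace (transpose M) = trace M"
  by (simp add: trace_def transpose_def)

section \<open>Trace identities on the rotation group\<close>

lemma skew_psi: "skew (psi M) = (1/2) *\<^sub>R (M - transpose M)"
  unfolding psi_def by (rule skew_vex) (simp add: transpose_def vec_eq_iff field_simps)

text \<open>Pairing with a skew-symmetric matrix only sees the skew-symmetric part of \<open>M\<close>, which is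
  \<open>skew (psi M)\<close>, and \<open>trace (skew a ** skew b) = - 2 * (a \<bullet> b)\<close>.\<close>

lemma trace_mult_skew: "trace (M ** skew x) = - 2 * (psi M \<bullet> x)"
proof -
  have e: "skew (psi M) $ i $ j = (M $ i $ j - M $ j $ i) / 2" for i j
    by (simp add: skew_psi transpose_def)
  have psi: "psi M $ 1 = (M $ 3 $ 2 - M $ 2 $ 3) / 2" "psi M $ 2 = (M $ 1 $ 3 - M $ 3 $ 1) / 2"
       "psi M $ 3 = (M $ 2 $ 1 - M $ 1 $ 2) / 2"
    using e[of 3 2] e[of 1 3] e[of 2 1] by (simp_all add: skew_def matrix_def cross3_def axis_def)
  show ?thesis
    by (simp add: trace_def sum_3 matrix_matrix_mult_def inner_vec_def skew_def matrix_def cross3_def axis_def psi)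
      (simp add: field_simps)
qed

text \<open>The trace form of \<open>skew u ** skew u = u u\<^sup>T - (u \<bullet> u) I\<close>.\<close>

lemma trace_mult_skew_square:
  "trace (A ** (skew u ** skew u)) = u \<bullet> (A *v u) - trace A * (u \<bullet> u)"
  by (simp add: trace_def sum_3 matrix_matrix_mult_def matrix_vector_mult_def inner_vec_def skew_def
      matrix_def cross3_def axis_def) (simp add: algebra_simps)

lemma quadratic_form_bar: "u \<bullet> (bar A *v u) = - (1/2) * trace (A ** (skew u ** skew u))"
  unfolding trace_mult_skew_square bar_def
  by (simp add: scaleR_matrix_vector_assoc[symmetric] matrix_vector_mult_diff_rdistrib inner_diff_right
     algebra_simps)

text \<open>Writing the inner product as a trace turns it into \<open>A ** Q ** (Q - Q\<^sup>T)\<close>, where orthogonality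
  reduces \<open>Q ** Q\<^sup>T\<close> to the identity. With the free matrix \<open>A\<close>, this yields both the length of
  \<open>psi Q\<close> and the rate of decay of the error.\<close>

lemma psi_inner_psi_mult:
  assumes "orthogonal_matrix Q"
  shows "psi Q \<bullet> psi (A ** Q) = (trace A - trace (A ** (Q ** Q))) / 4"
proof -
  have QQ: "Q ** transpose Q = mat 1"
    using assms by (simp add: orthogonal_matrix_def)
  have "psi (A ** Q) \<bullet> psi Q = - (1/2) * trace (A ** Q ** skew (psi Q))"
    by (simp add: trace_mult_skew)
  also have "\<dots> = (trace A - trace (A ** (Q ** Q))) / 4"
    unfolding skew_psi
    by (simp add: matrix_mult_scaleR_right trace_scaleR matrix_mult_diff_right trace_sub
        matrix_mul_assoc[symmetric] QQ field_simps)
  finally show ?thesis by (simp add: inner_commute)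
qed

text \<open>The right-hand side is a trace involving \<open>skew (psi Q)\<close> squared, that is
  \<open>(Q - Q\<^sup>T)\<^sup>2 / 4 = (Q\<^sup>2 + (Q\<^sup>T)\<^sup>2 - 2 I) / 4\<close> for orthogonal \<open>Q\<close>. Against a symmetric \<open>A\<close>, the terms
  \<open>Q\<^sup>2\<close> and \<open>(Q\<^sup>T)\<^sup>2\<close> have the same trace, which leaves the value found in
  \<open>psi_inner_psi_mult\<close>.\<close>

lemma psi_inner_psi_mult_eq_quadratic_form:
  assumes "transpose A = A" and Q: "orthogonal_matrix Q"
  shows "psi Q \<bullet> psi (A ** Q) = psi Q \<bullet> (bar A *v psi Q)"
proof -
  have tr: "trace (A ** (transpose Q ** transpose Q)) = trace (A ** (Q ** Q))"
    by (metis assms(1) matrix_transpose_mul trace_mul_sym trace_transpose)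
  have "(Q - transpose Q) ** (Q - transpose Q)
      = Q ** Q - mat 1 - (mat 1 - transpose Q ** transpose Q)"
    using Q by (simp add: orthogonal_matrix_def matrix_mult_diff_left matrix_mult_diff_right)
  then have "psi Q \<bullet> (bar A *v psi Q) =
      - (1/8) * trace (A ** (Q ** Q - mat 1 - (mat 1 - transpose Q ** transpose Q)))"
    unfolding quadratic_form_bar skew_psi
    by (simp add: matrix_mult_scaleR_left matrix_mult_scaleR_right trace_scaleR)
  also have "\<dots> = (trace A - trace (A ** (Q ** Q))) / 4"
    by (simp only: matrix_mult_diff_right matrix_mul_rid trace_sub tr) (simp add: field_simps)
  finally show ?thesis
    by (simp add: psi_inner_psi_mult[OF Q])
qed

text \<open>For any matrix, \<open>(trace Q)\<^sup>2 - trace (Q ** Q)\<close> is twice the sum of the principal \<open>2 \<times> 2\<close> minors.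
  A rotation preserves the cross product, so it equals its own cofactor matrix; hence these minors
  are its diagonal entries.\<close>

lemma trace_square_rotation:
  fixes Q :: "real^3^3"
  assumes "rotation_matrix Q"
  shows "trace (Q ** Q) = (trace Q)\<^sup>2 - 2 * trace Q"
proof -
  have cross: "cross3 (Q *v x) (Q *v y) $ k = (Q *v cross3 x y) $ k" for k x y
    using cross_rotation_matrix[OF assms] by simp
  have "Q$1$1 * Q$2$2 - Q$1$2 * Q$2$1 = Q$3$3"
    using cross[of "axis 1 1" "axis 2 1" 3]
    by (simp add: matrix_vector_mult_def sum_3 cross3_def axis_def algebra_simps)
  moreover have "Q$2$2 * Q$3$3 - Q$2$3 * Q$3$2 = Q$1$1"
    using cross[of "axis 2 1" "axis 3 1" 1]
    by (simp add: matrix_vector_mult_def sum_3 cross3_def axis_def algebra_simps)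
  moreover have "Q$1$1 * Q$3$3 - Q$1$3 * Q$3$1 = Q$2$2"
    using cross[of "axis 3 1" "axis 1 1" 2]
    by (simp add: matrix_vector_mult_def sum_3 cross3_def axis_def algebra_simps)
  ultimately show ?thesis
    by (simp add: trace_def sum_3 matrix_matrix_mult_def power2_eq_square) (simp add: algebra_simps)
qed

text \<open>The square of \<^const>\<open>att_norm\<close> on \<^const>\<open>SO3\<close>. Being affine in the matrix, it can be differentiated
  also where it vanishes, unlike \<^const>\<open>att_norm\<close> itself.\<close>
definition att_potential :: "real^3^3 \<Rightarrow> real" where
  "att_potential Q = trace (mat 1 - Q) / 4"

lemma att_potential_eq: "att_potential Q = (3 - trace Q) / 4"
  by (simp add: att_potential_def trace_sub trace_I)

text \<open>For a rotation by an angle \<open>\<theta>\<close> this is \<open>(sin \<theta>)\<^sup>2 = 4 (sin (\<theta>/2))\<^sup>2 (cos (\<theta>/2))\<^sup>2\<close>.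
  The proof takes \<open>A = mat 1\<close> in \<open>psi_inner_psi_mult\<close>.\<close>

lemma psi_inner_psi_rotation:
  assumes "Q \<in> SO3"
  shows "psi Q \<bullet> psi Q = 4 * att_potential Q * (1 - att_potential Q)"
proof -
  have "rotation_matrix Q" "orthogonal_matrix Q"
    using assms by (auto simp: SO3_def rotation_matrix_def)
  then show ?thesis
    using psi_inner_psi_mult[of Q "mat 1"]
    by (simp add: trace_square_rotation trace_I att_potential_eq power2_eq_square field_simps)
qed

text \<open>By \<open>psi_inner_psi_rotation\<close>, \<open>x (1 - x) \<ge> 0\<close> holds for \<open>x = att_potential Q\<close>.\<close>

lemma att_potential_bounds:
  assumes "Q \<in> SO3"
  shows "0 \<le> att_potential Q" "att_potential Q \<le> 1"
proof -
  have "0 \<le> att_potential Q * (1 - att_potential Q)"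
    using psi_inner_psi_rotation[OF assms] inner_ge_zero[of "psi Q"] by simp
  then show "0 \<le> att_potential Q" "att_potential Q \<le> 1"
    by (auto simp: zero_le_mult_iff)
qed

lemma att_norm_square:
  assumes "Q \<in> SO3"
  shows "(att_norm Q)\<^sup>2 = att_potential Q"
  using att_potential_bounds(1)[OF assms] by (simp add: att_norm_def att_potential_def)

section \<open>Matrix flows and exponential comparison\<close>

text \<open>The derivative of \<open>Q ** transpose Q\<close> is \<open>Q (S + S\<^sup>T) Q\<^sup>T = 0\<close>. The invariant is
  algebraic, so \<open>S\<close> may depend on time in any way.\<close>

lemma orthogonal_flow:
  fixes Q S :: "real \<Rightarrow> real^'n^'n"
  assumes deriv: "\<And>t. t \<ge> 0 \<Longrightarrow> (Q has_vector_derivative Q t ** S t) (at t within {0..})"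
    and skew: "\<And>t. transpose (S t) = - S t"
    and "orthogonal_matrix (Q 0)" and "t \<ge> 0"
  shows "orthogonal_matrix (Q t)"
proof -
  have "((\<lambda>t. Q t ** transpose (Q t)) has_vector_derivative 0) (at s within {0..})"
    if "s \<in> {0..}" for s
  proof -
    have "Q s ** transpose (Q s ** S s) + Q s ** S s ** transpose (Q s) = 0"
      by (simp add: matrix_transpose_mul skew matrix_mul_assoc matrix_mult_minus_right
          matrix_mult_minus_left)
    then show ?thesis
      using has_vector_derivative_matrix_mult[OF deriv has_vector_derivative_transpose[OF deriv]] that
      by fastforce
  qed
  then have "\<exists>C. \<forall>s\<in>{0..}. Q s ** transpose (Q s) = C"
    by (rule has_vector_derivative_zero_constant[OF convex_real_interval(1)]) auto
  then have "Q t ** transpose (Q t) = Q 0 ** transpose (Q 0)"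
    using \<open>t \<ge> 0\<close> by force
  with assms(3) show ?thesis
    using matrix_left_right_inverse by (auto simp: orthogonal_matrix_def)
qed

text \<open>Along an orthogonal curve the determinant is continuous with values in \<open>{- 1, 1}\<close>, so it keeps
  its initial sign.\<close>

lemma rotation_flow:
  fixes Q S :: "real \<Rightarrow> real^'n^'n"
  assumes deriv: "\<And>t. t \<ge> 0 \<Longrightarrow> (Q has_vector_derivative Q t ** S t) (at t within {0..})"
    and skew: "\<And>t. transpose (S t) = - S t"
    and "rotation_matrix (Q 0)" and "t \<ge> 0"
  shows "rotation_matrix (Q t)"
proof -
  have orth: "orthogonal_matrix (Q s)" if "s \<ge> 0" for s
    using orthogonal_flow[OF deriv skew _ that] assms(3) by (auto simp: rotation_matrix_def)
  have "continuous_on {0..} Q"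
    unfolding continuous_on_eq_continuous_within
    using deriv has_vector_derivative_continuous by fastforce
  then have "continuous_on {0..t} Q"
    by (rule continuous_on_subset) auto
  then have "continuous_on {0..t} (\<lambda>s. det (Q s))"
    unfolding det_def by (intro continuous_intros) auto
  moreover have "det (Q s) \<noteq> 0" if "0 \<le> s" for s
    using det_orthogonal_matrix[OF orth[OF that]] by auto
  ultimately have "det (Q t) > 0"
    using IVT2'[of "\<lambda>s. det (Q s)" t 0 0] \<open>t \<ge> 0\<close> assms(3)
    by (force simp: rotation_matrix_def)
  then show ?thesis
    using det_orthogonal_matrix[OF orth[OF assms(4)]] orth[OF assms(4)]
    by (auto simp: rotation_matrix_def)
qed

text \<open>Gronwall's inequality in differential form: \<open>y t * exp (c * t)\<close> is nonincreasing.\<close>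

lemma exponential_comparison:
  fixes y y' :: "real \<Rightarrow> real"
  assumes deriv: "\<And>t. t \<ge> 0 \<Longrightarrow> (y has_real_derivative y' t) (at t within {0..})"
    and le: "\<And>t. t \<ge> 0 \<Longrightarrow> y' t \<le> - c * y t" and "t \<ge> 0"
  shows "y t \<le> y 0 * exp (- c * t)"
proof -
  have d: "((\<lambda>s. y s * exp (c * s)) has_real_derivative (y' s + c * y s) * exp (c * s))
      (at s within {0..})" if "s \<ge> 0" for s
    using deriv[OF that] by (auto intro!: derivative_eq_intros simp: algebra_simps)
  have "y t * exp (c * t) \<le> y 0 * exp (c * 0)"
  proof (rule DERIV_nonpos_imp_decreasing_open[OF \<open>t \<ge> 0\<close>])
    fix s assume "0 < s" "s < t"
    then have "((\<lambda>s. y s * exp (c * s)) has_real_derivative (y' s + c * y s) * exp (c * s)) (at s)"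
      using d[of s] at_within_interior[of s "{0..}"] by simp
    moreover have "(y' s + c * y s) * exp (c * s) \<le> 0"
      using le[of s] \<open>0 < s\<close> by (simp add: mult_le_0_iff)
    ultimately show "\<exists>d. ((\<lambda>s. y s * exp (c * s)) has_real_derivative d) (at s) \<and> d \<le> 0"
      by blast
  next
    have "continuous_on {0..} (\<lambda>s. y s * exp (c * s))"
      using d by (intro DERIV_continuous_on) auto
    then show "continuous_on {0..t} (\<lambda>s. y s * exp (c * s))"
      by (rule continuous_on_subset) auto
  qed
  then show ?thesis
    by (simp add: exp_minus field_simps)
qed

section \<open>The attitude error\<close>

text \<open>The angular velocity \<open>w\<close> cancels because the observer copies it, and what remains is the
  correction \<open>s\<close>, now acting from the right.\<close>

lemma attitude_error_derivative:
  fixes R Rh :: "real \<Rightarrow> real^3^3"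
  assumes "(R has_vector_derivative R t ** skew w) (at t within T)"
    and "(Rh has_vector_derivative (Rh t ** skew w - skew s ** Rh t)) (at t within T)"
  shows "((\<lambda>t. R t ** transpose (Rh t)) has_vector_derivative
           R t ** transpose (Rh t) ** skew s) (at t within T)"
proof -
  have "R t ** transpose (Rh t ** skew w - skew s ** Rh t) + R t ** skew w ** transpose (Rh t)
      = R t ** transpose (Rh t) ** skew s"
    by (simp add: linear_diff[OF bounded_linear.linear[OF bounded_linear_transpose]]
        matrix_transpose_mul transpose_skew matrix_mult_minus_left matrix_mult_minus_right
        matrix_mult_diff_right matrix_mul_assoc)
  then show ?thesis
    using has_vector_derivative_matrix_mult[OF assms(1) has_vector_derivative_transpose[OF assms(2)]]
    by simp
qed

lemma att_potential_derivative:
  assumes "(Q has_vector_derivative Q t ** skew s) (at t within T)"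
  shows "((\<lambda>t. att_potential (Q t)) has_real_derivative (psi (Q t) \<bullet> s) / 2) (at t within T)"
  unfolding att_potential_eq
  using has_vector_derivative_trace[OF assms]
  by (auto simp: has_real_derivative_iff_has_vector_derivative[symmetric] trace_mult_skew
      intro!: derivative_eq_intros)

theorem theorem3:
  fixes A :: "real^3^3" and \<epsilon> \<gamma> \<xi>\<^sub>0 :: real
    and \<omega> :: "real \<Rightarrow> real^3" and R Rh Rt :: "real \<Rightarrow> real^3^3"
  assumes "transpose A = A" and "pos_def (bar A)"
    and "\<epsilon> > 0" and "\<gamma> > 0" and "\<gamma> < inverse (1 + \<epsilon>)"
    and "\<xi>\<^sub>0 = 1 - \<gamma> * \<epsilon> / (1 - \<gamma>)"
    and "R 0 \<in> SO3"
    and "\<And>t. t \<ge> 0 \<Longrightarrow> (R has_vector_derivative R t ** skew (\<omega> t)) (at t within {0..})"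
    and "Rh 0 \<in> SO3"
    and "\<And>t. t \<ge> 0 \<Longrightarrow> (Rh has_vector_derivative
           (Rh t ** skew (\<omega> t) - skew (sigma_k3 \<epsilon> A (R t) (Rh t)) ** Rh t)) (at t within {0..})"
    and "\<And>t. t \<ge> 0 \<Longrightarrow> Rt t = R t ** transpose (Rh t)"
    and "Rt 0 \<in> att_ball \<xi>\<^sub>0"
  shows "\<forall>t\<ge>0. att_norm (Rt 0) * exp (- lambda_max (bar A) * t) \<le> att_norm (Rt t)
             \<and> att_norm (Rt t) \<le> att_norm (Rt 0) * exp (- \<gamma> * lambda_min (bar A) * t)"
proof -
  define Q where "Q t = R t ** transpose (Rh t)" for t
  define s where "s t = sigma_k3 \<epsilon> A (R t) (Rh t)" for t
  define V where "V t = att_potential (Q t)" for t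
  define k where "k t = inverse (1 + \<epsilon> - V t)" for t
  define q where "q t = psi (Q t) \<bullet> (bar A *v psi (Q t))" for t
  let ?m = "lambda_min (bar A)" and ?M = "lambda_max (bar A)"
  have sym: "transpose (bar A) = bar A"
    using assms(2) by (simp add: pos_def_def)
  have m_pos: "?m > 0"
    using pos_def_lambda_min_pos assms(2) .
  have dQ: "(Q has_vector_derivative Q t ** skew (s t)) (at t within {0..})" if "t \<ge> 0" for t
    unfolding Q_def s_def using attitude_error_derivative[OF assms(8,10)[OF that]] .
  have Q: "Q t \<in> SO3" if "t \<ge> 0" for t
    using rotation_flow[OF dQ transpose_skew _ that] assms(11,12)
    by (simp add: SO3_def att_ball_def Q_def)
  have norm_eq: "att_norm (Rt t) = sqrt (V t)" if "t \<ge> 0" for t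
    using assms(11)[OF that] by (simp add: V_def Q_def att_norm_def att_potential_def)
  have V: "0 \<le> V t" "V t \<le> 1" if "t \<ge> 0" for t
    using att_potential_bounds[OF Q[OF that]] by (simp_all add: V_def)
  have k_pos: "k t > 0" if "t \<ge> 0" for t
    using V[OF that] \<open>\<epsilon> > 0\<close> by (simp add: k_def)
  have q_bounds: "?m * (4 * V t * (1 - V t)) \<le> q t" "q t \<le> ?M * (4 * V t * (1 - V t))"
    if "t \<ge> 0" for t
    using lambda_min_le_quadratic_form[OF sym, of "psi (Q t)"]
      quadratic_form_le_lambda_max[OF sym, of "psi (Q t)"] psi_inner_psi_rotation[OF Q[OF that]]
    by (simp_all add: q_def V_def)
  have M_nonneg: "?M \<ge> 0"
  proof -
    have "axis 1 1 \<bullet> (bar A *v axis 1 1) > 0"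
      using assms(2) by (auto simp: pos_def_def axis_eq_0_iff)
    then show ?thesis
      using quadratic_form_le_lambda_max[OF sym, of "axis 1 1"] by simp
  qed
  have dV: "(V has_real_derivative - (k t * q t) / 2) (at t within {0..})" if "t \<ge> 0" for t
  proof -
    have "orthogonal_matrix (Q t)"
      using Q[OF that] by (simp add: SO3_def rotation_matrix_def)
    then have "psi (Q t) \<bullet> psi (A ** Q t) = q t"
      unfolding q_def by (rule psi_inner_psi_mult_eq_quadratic_form[OF assms(1)])
    moreover have "s t = - k t *\<^sub>R psi (A ** Q t)"
      using att_norm_square[OF Q[OF that]]
      by (simp add: s_def sigma_k3_def gain_k3_def k_def V_def Q_def matrix_mul_assoc)
    ultimately show ?thesis
      using att_potential_derivative[OF dQ[OF that]] by (simp add: V_def[abs_def])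
  qed
  \<comment> \<open>Comparison with rate 0: the potential does not grow, so the error never leaves the ball
    in which the gain estimate below holds.\<close>
  have V_le: "V t \<le> V 0" if "t \<ge> 0" for t
  proof -
    have "- (k u * q u) / 2 \<le> - 0 * V u" if "u \<ge> 0" for u
    proof -
      have "0 \<le> ?m * (4 * V u * (1 - V u))"
        using V[OF that] m_pos by simp
      also have "\<dots> \<le> q u"
        by (rule q_bounds(1)[OF that])
      finally show ?thesis
        using k_pos[OF that] by simp
    qed
    from exponential_comparison[OF dV this that] show ?thesis by simp
  qed
  have "\<gamma> * (1 + \<epsilon>) < 1"
    using assms(3,5) by (simp add: field_simps)
  then have "\<gamma> < 1"
    using assms(3,4) by (simp add: distrib_left) (smt (verit) mult_pos_pos)
  have V_less: "V t < \<xi>\<^sub>0" if "t \<ge> 0" for t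
    using V_le[OF that] assms(11)[of 0] assms(12) att_norm_square[OF Q[of 0]]
    by (simp add: att_ball_def V_def Q_def)
  \<comment> \<open>On the ball the gain compensates the factor \<open>1 - V\<close> up to \<open>\<gamma>\<close>: the inequality
    \<open>\<gamma> \<le> (1 - V) / (1 + \<epsilon> - V)\<close> is \<open>V \<le> \<xi>\<^sub>0\<close> rearranged.\<close>
  have gain: "\<gamma> \<le> k t * (1 - V t)" "k t * (1 - V t) \<le> 1" if "t \<ge> 0" for t
  proof -
    have "V t * (1 - \<gamma>) \<le> 1 - \<gamma> - \<gamma> * \<epsilon>"
      using V_less[OF that] \<open>\<gamma> < 1\<close> by (simp add: assms(6) field_simps)
    then have "\<gamma> * (1 + \<epsilon> - V t) \<le> 1 - V t"
      by (simp add: algebra_simps)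
    then show "\<gamma> \<le> k t * (1 - V t)" "k t * (1 - V t) \<le> 1"
      using V[OF that] assms(3) by (simp_all add: k_def field_simps)
  qed
  have upper: "- (k t * q t) / 2 \<le> - (2 * \<gamma> * ?m) * V t" if "t \<ge> 0" for t
  proof -
    have "\<gamma> * (2 * ?m * V t) \<le> k t * (1 - V t) * (2 * ?m * V t)"
      using gain(1)[OF that] V[OF that] m_pos by (intro mult_right_mono) auto
    also have "\<dots> \<le> k t * q t / 2"
      using mult_left_mono[OF q_bounds(1)[OF that], of "k t"] k_pos[OF that]
      by (simp add: algebra_simps)
    finally show ?thesis by simp
  qed
  \<comment> \<open>Stated for \<open>- V\<close>, so that the same comparison lemma yields a lower bound on \<open>V\<close>.\<close>
  have lower: "k t * q t / 2 \<le> - (2 * ?M) * - V t" if "t \<ge> 0" for t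
  proof -
    have "k t * q t / 2 \<le> k t * (1 - V t) * (2 * ?M * V t)"
      using mult_left_mono[OF q_bounds(2)[OF that], of "k t"] k_pos[OF that]
      by (simp add: algebra_simps)
    also have "\<dots> \<le> 1 * (2 * ?M * V t)"
      using gain(2)[OF that] V[OF that] M_nonneg by (intro mult_right_mono) auto
    finally show ?thesis by simp
  qed
  have sqrt_exp: "sqrt (V 0 * exp (- (2 * c) * t)) = sqrt (V 0) * exp (- c * t)" for c t
  proof -
    have "exp (- (2 * c) * t) = (exp (- c * t))\<^sup>2"
      using exp_double[of "- c * t"] by (simp add: mult.assoc)
    then show ?thesis
      by (simp only: real_sqrt_mult) simp
  qed
  show ?thesis
  proof (intro allI impI conjI)
    fix t :: real assume "t \<ge> 0"
    have "- V t \<le> - V 0 * exp (- (2 * ?M) * t)"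
      by (rule exponential_comparison[OF _ lower \<open>t \<ge> 0\<close>]) (use DERIV_minus[OF dV] in simp)
    then have "sqrt (V 0 * exp (- (2 * ?M) * t)) \<le> sqrt (V t)"
      by simp
    then show "att_norm (Rt 0) * exp (- ?M * t) \<le> att_norm (Rt t)"
      unfolding sqrt_exp using \<open>t \<ge> 0\<close> by (simp add: norm_eq)
    have "V t \<le> V 0 * exp (- (2 * \<gamma> * ?m) * t)"
      using exponential_comparison[OF dV upper \<open>t \<ge> 0\<close>] .
    then have "sqrt (V t) \<le> sqrt (V 0 * exp (- (2 * (\<gamma> * ?m)) * t))"
      by (simp add: mult.assoc)
    then show "att_norm (Rt t) \<le> att_norm (Rt 0) * exp (- \<gamma> * ?m * t)"
      unfolding sqrt_exp using \<open>t \<ge> 0\<close> by (simp add: norm_eq)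
  qed
qed

end
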